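(* For continuous $n$-player Guts ($n\ge2$), the strategy $p_1^*=(1/2)^{1/(n-1)}$ satisfies the following termination condition with respect to bloc strategies $p_2^*=p_3^*=\dots=p_n^*$: there is $\varepsilon\in(0,1)$ such that for all $p_2^*\in[0,1]$, writing $\alpha=\alpha(p_1^*,p_2^*,\dots,p_2^* )$ and $\beta=\beta(p_1^*,p_2^*,\dots,p_2^* )$, $$\alpha\ge0,\qquad \beta\ge0,\qquad \alpha\ge(\beta-1)+\varepsilon .$$ Thus it is optimal against bloc strategies in the strong sense that it can force with probability $1$ termination of the game (naturally or by the exit option) with an expected total return $\ge0$.
   Context: Continuous $n$-player Guts: players $1,\dots,n$ receive independent hands $p_1,\dots,p_n$ uniform on $[0,1]$. A pure strategy of player $i$ is a threshold $p_i^*\in[0,1]$: hold if $p_i\ge p_i^*$, drop if $p_i<p_i^*$. Each ante is one unit, so the pot is $n$. Let $r$ be the number of holding players. If $r=0$, the immediate return to each player is $0$ and the game is replayed with stakes factor $1$. If $r\ge1$, the stakes factor for the replay is $r-1$ (factor $0$ means the game ends) and a player's immediate return is $(r-2)+n$ if the player holds and has the highest hand among holders, $(r-2)-n$ if the player holds but does not have the highest hand, and $r-2$ if the player drops. $\alpha(p_1^*,\dots,p_n^* )$ is the expected immediate return to player 1, $\beta(p_1^*,\dots,p_n^* )$ the expected stakes factor. A bloc strategy of players 2-$n$ is one with $p_2^*=\dots=p_n^*$ in each round. Player 1 may exit at any time by forfeiting the ante (fee $1$ times current stakes). The return that repeating $p_1^*$ forces against bloc strategies in the $n'$-truncated game (player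 1 exits after at most $n'$ rounds, so that play terminates with certainty) is $g_{n'}$, where $g_0=-1$, $g_{k+1}=\inf_{q\in[0,1]}[\alpha(p_1^*,q,\dots,q)+\beta(p_1^*,q,\dots,q)g_k]$. "Forcing an expected total return $\ge0$" means $\sup_{k}g_k\ge0$. *)

theory Defs
  imports "HOL-Probability.Probability"
begin

text \<open>
  Continuous \<open>n\<close>-player Guts.  Players are the naturals \<open>1..n\<close>; a hand profile and a
  threshold profile are functions \<open>nat \<Rightarrow> real\<close>, of which only the values on \<open>{1..n}\<close> matter.
\<close>

definition hands :: "nat \<Rightarrow> (nat \<Rightarrow> real) measure" where
  "hands n = PiM {1..n} (\<lambda>_. uniform_measure lborel {0..1})"

definition holders :: "nat \<Rightarrow> (nat \<Rightarrow> real) \<Rightarrow> (nat \<Rightarrow> real) \<Rightarrow> nat set" where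
  "holders n t h = {i \<in> {1..n}. t i \<le> h i}"

text \<open>
  In \<open>immediate_return\<close>, tied highest holders would all count as winners; ties have
  probability zero, so this does not affect any expectation.
\<close>

definition immediate_return :: "nat \<Rightarrow> (nat \<Rightarrow> real) \<Rightarrow> nat \<Rightarrow> (nat \<Rightarrow> real) \<Rightarrow> real" where
  "immediate_return n t i h =
    (let H = holders n t h; r = real (card H) in
     if H = {} then 0
     else if i \<notin> H then r - 2
     else if \<forall>j\<in>H. h j \<le> h i then (r - 2) + real n
     else (r - 2) - real n)"

definition stakes_factor :: "nat \<Rightarrow> (nat \<Rightarrow> real) \<Rightarrow> (nat \<Rightarrow> real) \<Rightarrow> real" where
  "stakes_factor n t h =
    (let H = holders n t h in if H = {} then 1 else real (card H) - 1)"

definition alpha :: "nat \<Rightarrow> (nat \<Rightarrow> real) \<Rightarrow> real" where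
  "alpha n t = (\<integral>h. immediate_return n t 1 h \<partial>hands n)"

definition beta :: "nat \<Rightarrow> (nat \<Rightarrow> real) \<Rightarrow> real" where
  "beta n t = (\<integral>h. stakes_factor n t h \<partial>hands n)"

definition bloc :: "real \<Rightarrow> real \<Rightarrow> nat \<Rightarrow> real" where
  "bloc p q = (\<lambda>i. if i = 1 then p else q)"

text \<open>
  \<open>forced_return n p k\<close> is the return, in units of the current stakes, that player 1 forces
  against bloc strategies by repeating the threshold \<open>p\<close> and exiting (forfeiting one ante)
  if the game is still running after \<open>k\<close> rounds; such play ends within \<open>k\<close> rounds with
  certainty.  The bloc may choose a new threshold \<open>q\<close> in each round.  As
  \<open>immediate_return\<close> and \<open>stakes_factor\<close> are bounded in terms of \<open>n\<close>, the infimum is over a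
  nonempty bounded set of reals.
\<close>

primrec forced_return :: "nat \<Rightarrow> real \<Rightarrow> nat \<Rightarrow> real" where
  "forced_return n p 0 = -1"
| "forced_return n p (Suc k) =
    (INF q\<in>{0..1}. alpha n (bloc p q) + beta n (bloc p q) * forced_return n p k)"

end

theory Submission
  imports Defs
begin

text \<open>
  Write \<open>m = n - 1\<close> for the number of opponents, so that \<open>p ^ m = 1/2\<close>.  Conditioning on the hand
  of player 1, an opponent does not beat a hand \<open>x\<close> with probability \<open>max q x\<close> (he drops, or holds a
  hand at most \<open>x\<close>).  Hence player 1 holds and wins with probability \<open>W\<close>, the integral of
  \<open>max q x ^ m\<close> over \<open>{p..1}\<close>.  Counting holders by linearity of expectation and correcting for the
  event that nobody holds, of probability \<open>p * q ^ m\<close>, gives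

    \<^item> \<open>beta = m * (1 - q) - p + 2 * p * q ^ m\<close>,
    \<^item> \<open>alpha = beta - 1 + n * (2 * W - (1 - p))\<close>.

  These closed forms are \<open>beta_bloc\<close> and \<open>alpha_bloc\<close>.  For \<open>p ^ m = 1/2\<close> the second one becomes
  \<open>2 * p * q ^ m - (p + m * (q - p))\<close> if \<open>q \<le> p\<close>, and \<open>m * (q - p) * (2 * q ^ m - 1)\<close> if \<open>p \<le> q\<close>.
  The threshold \<open>p\<close> is exactly the one for which the tangent at \<open>q = p\<close> of the convex function
  \<open>2 * p * q ^ m\<close> has slope \<open>m\<close>; so the first expression is the nonnegative gap between this function
  and its tangent.  The second is a product of nonnegative factors.  The same tangent gives
  \<open>beta \<ge> m * (1 - p) \<ge> 0\<close>.

  The difference \<open>alpha - beta + 1\<close> is constantly \<open>1 - m * (1 - p)\<close> for \<open>q \<le> p\<close> and at least that for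
  \<open>q \<ge> p\<close>, again by a tangent inequality.  As \<open>(1/p) ^ m = 2\<close>, Bernoulli's inequality bounds
  \<open>m * (1 - p)\<close> by \<open>p\<close>, and \<open>\<epsilon> = 1 - p\<close> works.

  Finally, if \<open>g \<ge> - x\<close> with \<open>0 \<le> x \<le> 1\<close>, then \<open>alpha + beta * g \<ge> alpha - x * beta \<ge> x * (alpha - beta)
  \<ge> - (1 - \<epsilon>) * x\<close>.  One more round thus shrinks the possible loss by the factor \<open>1 - \<epsilon>\<close>, and the
  returns forced by longer and longer play are bounded below by a sequence tending to \<open>0\<close>.
\<close>

section \<open>Elementary inequalities\<close>

text \<open>
  The convex function \<open>q \<mapsto> q ^ (k + 1)\<close> lies above its tangent at \<open>p\<close>.  After division by \<open>p ^ (k + 1)\<close>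
  this is Bernoulli's inequality for \<open>q / p - 1\<close>.
\<close>
lemma power_ge_tangent:
  fixes p q :: real
  assumes "0 < p" "0 \<le> q"
  shows "p ^ k * (p + (real k + 1) * (q - p)) \<le> q ^ Suc k"
proof -
  have "1 + real (Suc k) * (q / p - 1) \<le> (1 + (q / p - 1)) ^ Suc k"
    by (rule Bernoulli_inequality) (use assms in simp)
  also have "\<dots> = q ^ Suc k / p ^ Suc k"
    by (simp only: add_diff_eq add_diff_cancel_left' power_divide)
  finally have "(1 + real (Suc k) * (q / p - 1)) * p ^ Suc k \<le> q ^ Suc k"
    using assms by (simp only: pos_le_divide_eq zero_less_power)
  moreover have "(1 + real (Suc k) * (q / p - 1)) * p ^ Suc k
      = p ^ k * (p + (real k + 1) * (q - p))"
  proof -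
    have "(1 + real (Suc k) * (q / p - 1)) * p = p + (real k + 1) * (q - p)"
      using assms by (simp add: field_simps)
    then show ?thesis by (simp add: mult.assoc[symmetric] mult.commute)
  qed
  ultimately show ?thesis by (simp only:)
qed

text \<open>
  Bernoulli's inequality for \<open>1/p\<close>, whose \<open>m\<close>-th power is \<open>2\<close>.  This is what keeps the factor by
  which the stakes-weighted loss shrinks away from \<open>1\<close>.
\<close>
lemma half_power_bound:
  fixes p :: real
  assumes "0 < p" "p ^ m = 1/2"
  shows "real m * (1 - p) \<le> p"
proof -
  have "1 + real m * (1 / p - 1) \<le> (1 + (1 / p - 1)) ^ m"
    by (rule Bernoulli_inequality) (use assms in simp)
  also have "\<dots> = 1 / p ^ m" by (simp add: power_divide)
  also have "\<dots> = 2" unfolding assms(2) by simp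
  finally have "real m * (1 / p - 1) * p \<le> 1 * p"
    using assms by (intro mult_right_mono) auto
  moreover have "real m * (1 / p - 1) * p = real m * (1 - p)"
    using assms(1) by (simp add: field_simps)
  ultimately show ?thesis by linarith
qed

text \<open>
  Since \<open>2 * p ^ m = 1\<close>, the function \<open>q \<mapsto> 2 * p * q ^ m\<close> has value \<open>p\<close> and slope \<open>m\<close> at \<open>q = p\<close>.
\<close>
lemma twice_root_power_ge_tangent:
  fixes p q :: real
  assumes "0 < p" "p ^ m = 1/2" "0 \<le> q"
  shows "2 * p * q ^ m \<ge> p + real m * (q - p)"
proof (cases m)
  case 0
  then show ?thesis using assms by simp
next
  case (Suc k)
  have "2 * p * (p ^ k * (p + (real k + 1) * (q - p))) \<le> 2 * p * q ^ m"
    using power_ge_tangent[OF assms(1,3), of k] assms Suc by (intro mult_left_mono) auto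
  moreover have "2 * p * (p ^ k * (p + (real k + 1) * (q - p))) = p + real m * (q - p)"
  proof -
    have "2 * p * p ^ k = 1" using assms Suc by simp
    then have "2 * p * p ^ k * (p + (real k + 1) * (q - p)) = 1 * (p + (real k + 1) * (q - p))"
      by (rule arg_cong)
    then show ?thesis using Suc by (simp only: mult.assoc mult_1 of_nat_Suc add.commute)
  qed
  ultimately show ?thesis by linarith
qed

text \<open>
  Closed forms for \<open>m\<close> opponents sharing the threshold \<open>q\<close>.  In \<open>bloc_beta\<close>, the expected number of
  holders less one is \<open>(1 - p) + m * (1 - q) - 1\<close>; the last summand raises the stakes factor from
  \<open>-1\<close> to \<open>1\<close> when nobody holds.  The quantity \<open>bloc_win\<close> is the integral of \<open>max q x ^ m\<close> over
  \<open>{p..1}\<close>, with both orders of \<open>p\<close> and \<open>q\<close> in one formula.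
\<close>
definition bloc_beta :: "nat \<Rightarrow> real \<Rightarrow> real \<Rightarrow> real" where
  "bloc_beta m p q = real m * (1 - q) - p + 2 * p * q ^ m"

definition bloc_win :: "nat \<Rightarrow> real \<Rightarrow> real \<Rightarrow> real" where
  "bloc_win m p q =
    max 0 (q - p) * q ^ m + (1 - max p q ^ Suc m) / (real m + 1)"

definition bloc_alpha :: "nat \<Rightarrow> real \<Rightarrow> real \<Rightarrow> real" where
  "bloc_alpha m p q =
    bloc_beta m p q - 1 + (real m + 1) * (2 * bloc_win m p q - (1 - p))"

lemma bloc_alpha_looser:
  assumes "p ^ m = 1/2" "q \<le> p"
  shows "bloc_alpha m p q = 2 * p * q ^ m - p - real m * (q - p)"
proof -
  have "(real m + 1) * bloc_win m p q = 1 - p / 2"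
    using assms by (simp add: bloc_win_def)
  then show ?thesis
    unfolding bloc_alpha_def bloc_beta_def by (simp add: algebra_simps)
qed

lemma bloc_alpha_tighter:
  assumes "p \<le> q"
  shows "bloc_alpha m p q = real m * (q - p) * (2 * q ^ m - 1)"
proof -
  have "(real m + 1) * bloc_win m p q = (real m + 1) * (q - p) * q ^ m + 1 - q * q ^ m"
    using assms by (simp add: bloc_win_def distrib_left mult.assoc max_absorb2)
  then show ?thesis
    unfolding bloc_alpha_def bloc_beta_def by (simp add: algebra_simps)
qed

lemma bloc_beta_nonneg:
  assumes "0 < p" "p < 1" "p ^ m = 1/2" "0 \<le> q"
  shows "bloc_beta m p q \<ge> 0"
proof -
  have "bloc_beta m p q \<ge> real m * (1 - p)"
    using twice_root_power_ge_tangent[OF assms(1,3,4)]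
    by (simp add: bloc_beta_def algebra_simps)
  moreover have "real m * (1 - p) \<ge> 0" using assms by simp
  ultimately show ?thesis by linarith
qed

lemma bloc_alpha_nonneg:
  assumes "0 < p" "p ^ m = 1/2" "0 \<le> q"
  shows "bloc_alpha m p q \<ge> 0"
proof (cases "q \<le> p")
  case True
  then show ?thesis
    using twice_root_power_ge_tangent[OF assms] by (simp add: bloc_alpha_looser assms)
next
  case False
  then have "q ^ m \<ge> p ^ m" using assms by (intro power_mono) auto
  then show ?thesis using False assms by (simp add: bloc_alpha_tighter)
qed

text \<open>
  For \<open>q \<le> p\<close> the dependence on \<open>q\<close> cancels.  For \<open>q > p\<close> one uses the tangent of \<open>x \<mapsto> x ^ (m + 1)\<close>
  at \<open>q\<close>, compared with its value \<open>p / 2\<close> at \<open>p\<close>; equality at \<open>q = p\<close> shows that the two cases have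
  the same minimum.
\<close>
lemma bloc_alpha_minus_beta:
  assumes "0 < p" "p ^ m = 1/2" "0 \<le> q"
  shows "bloc_alpha m p q \<ge> bloc_beta m p q - 1 + (1 - p)"
proof -
  have "bloc_alpha m p q - bloc_beta m p q + 1 \<ge> 1 - real m * (1 - p)"
  proof (cases "q \<le> p")
    case True
    then show ?thesis
      using assms by (simp add: bloc_alpha_looser bloc_beta_def algebra_simps)
  next
    case False
    then have q: "p \<le> q" "0 < q" using assms by auto
    \<comment> \<open>The roles of \<open>p\<close> and \<open>q\<close> are exchanged here: the tangent is taken at \<open>q\<close>.\<close>
    have "q ^ m * (q + (real m + 1) * (p - q)) \<le> p / 2"
      using power_ge_tangent[of q p m] q assms by simp
    then show ?thesis
      using q by (simp add: bloc_alpha_tighter bloc_beta_def algebra_simps)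
  qed
  then show ?thesis using half_power_bound[OF assms(1,2)] by linarith
qed

section \<open>Expectations over independent uniform hands\<close>

abbreviation unif :: "real measure" where
  "unif \<equiv> uniform_measure lborel {0..1}"

lemma prob_space_unif: "prob_space unif"
  by (rule prob_space_uniform_measure) auto

interpretation hands: product_sigma_finite "\<lambda>_::nat. unif"
  by (intro product_sigma_finite.intro prob_space_imp_sigma_finite prob_space_unif)

lemma prob_space_hands: "prob_space (hands n)"
  unfolding hands_def by (rule prob_space_PiM) (rule prob_space_unif)

lemma sets_hands [measurable_cong]: "sets (hands n) = sets (PiM {1..n} (\<lambda>_. borel))"
  unfolding hands_def by (rule sets_PiM_cong) auto

lemma emeasure_unif_below:
  assumes "0 \<le> q" "q \<le> 1"
  shows "emeasure unif {..<q} = ennreal q" "emeasure unif {..q} = ennreal q"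
proof -
  have "{0..1} \<inter> {..<q} = {0..<q}" "{0..1} \<inter> {..q} = {0..q}" using assms by auto
  then show "emeasure unif {..<q} = ennreal q" "emeasure unif {..q} = ennreal q"
    using assms divide_ennreal[of q 1] by simp_all
qed

lemma emeasure_box:
  fixes I :: "nat set"
  assumes "\<And>i. i \<in> I \<Longrightarrow> A i \<in> sets borel" "finite I"
  shows "emeasure (PiM I (\<lambda>_. unif)) {h \<in> space (PiM I (\<lambda>_. unif)). \<forall>i\<in>I. h i \<in> A i}
    = (\<Prod>i\<in>I. emeasure unif (A i))"
proof -
  have "{h \<in> space (PiM I (\<lambda>_. unif)). \<forall>i\<in>I. h i \<in> A i} = Pi\<^sub>E I A"
    by (auto simp: space_PiM PiE_def Pi_def extensional_def)
  moreover have "emeasure (PiM I (\<lambda>_. unif)) (Pi\<^sub>E I A) = (\<Prod>i\<in>I. emeasure unif (A i))"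
    by (rule hands.emeasure_PiM) (use assms in auto)
  ultimately show ?thesis by (simp only:)
qed

lemma expectation_holds:
  assumes "i \<in> {1..n}" "0 \<le> q" "q \<le> 1"
  shows "(\<integral>h. indicat_real {q..} (h i) \<partial>hands n) = 1 - q"
proof -
  have "(\<integral>h. indicat_real {q..} (h i) \<partial>hands n)
      = (\<integral>x. indicat_real {q..} x \<partial>distr (hands n) unif (\<lambda>h. h i))"
    by (rule integral_distr[symmetric])
       (use assms in \<open>auto simp: hands_def intro!: measurable_component_singleton\<close>)
  also have "distr (hands n) unif (\<lambda>h. h i) = unif"
    unfolding hands_def using assms by (intro distr_PiM_component prob_space_unif) auto
  also have "(\<integral>x. indicat_real {q..} x \<partial>unif) = measure unif {q..}"
    by simp
  also have "\<dots> = measure lborel ({0..1} \<inter> {q..}) / measure lborel {0..1::real}"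
    by (rule measure_uniform_measure) auto
  also have "{0..1} \<inter> {q..} = {q..1}" using assms by auto
  finally show ?thesis using assms by simp
qed

text \<open>
  The two events whose probabilities enter the expectations.  The second one ties player 1's win to
  the opponents individually: each of them has dropped or holds no better hand.
\<close>
definition all_drop :: "nat \<Rightarrow> (nat \<Rightarrow> real) \<Rightarrow> (nat \<Rightarrow> real) set" where
  "all_drop n t = {h \<in> space (hands n). \<forall>i\<in>{1..n}. h i < t i}"

definition wins :: "nat \<Rightarrow> real \<Rightarrow> real \<Rightarrow> (nat \<Rightarrow> real) set" where
  "wins n p q = {h \<in> space (hands n). p \<le> h 1 \<and> (\<forall>j\<in>{2..n}. h j < q \<or> h j \<le> h 1)}"

lemma all_drop_sets [measurable]: "all_drop n t \<in> sets (hands n)"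
  unfolding all_drop_def by measurable

lemma wins_sets [measurable]:
  assumes "n \<ge> 1" shows "wins n p q \<in> sets (hands n)"
proof -
  have comp: "(\<lambda>h. h j) \<in> borel_measurable (hands n)" if "j \<in> {1..n}" for j
    using that by measurable
  have one: "(\<lambda>h. h 1) \<in> borel_measurable (hands n)"
    using assms by (intro comp) simp
  have "{h \<in> space (hands n). h j < q \<or> h j \<le> h 1} \<in> sets (hands n)" if "j \<in> {2..n}" for j
  proof (intro sets.sets_Collect_disj borel_measurable_less borel_measurable_le)
    show "(\<lambda>h. h j) \<in> borel_measurable (hands n)" using that by (intro comp) simp
    then show "(\<lambda>h. h j) \<in> borel_measurable (hands n)" .
  qed (use one in auto)
  then show ?thesis
    unfolding wins_def using one
    by (intro sets.sets_Collect_conj sets.sets_Collect_finite_All borel_measurable_le) auto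
qed

lemma measure_all_drop:
  assumes "\<And>i. i \<in> {1..n} \<Longrightarrow> 0 \<le> t i \<and> t i \<le> 1"
  shows "measure (hands n) (all_drop n t) = (\<Prod>i\<in>{1..n}. t i)"
proof -
  have "emeasure (hands n) (all_drop n t) = (\<Prod>i\<in>{1..n}. emeasure unif {..<t i})"
    using emeasure_box[of "{1..n}" "\<lambda>i. {..<t i}"] by (simp add: hands_def all_drop_def)
  also have "\<dots> = (\<Prod>i\<in>{1..n}. ennreal (t i))"
    using assms by (intro prod.cong refl emeasure_unif_below) auto
  also have "\<dots> = ennreal (\<Prod>i\<in>{1..n}. t i)"
    using assms by (intro prod_ennreal) auto
  finally show ?thesis
    using prod_nonneg[of "{1..n}" t] assms by (simp only: measure_def enn2real_ennreal)
qed

lemma has_integral_power_max: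
  fixes p q :: real
  assumes "0 \<le> p" "p \<le> 1" "0 \<le> q" "q \<le> 1"
  shows "((\<lambda>x. max q x ^ m) has_integral bloc_win m p q) {p..1}"
proof -
  have pow: "((\<lambda>x. max q x ^ m) has_integral (1 - a ^ Suc m) / (real m + 1)) {a..1}"
    if a: "q \<le> a" "a \<le> 1" for a
  proof -
    have "((\<lambda>x. x ^ Suc m / (real m + 1)) has_real_derivative x ^ m) (at x within {a..1})" for x
      using DERIV_cdivide[OF DERIV_pow[of "Suc m" x "{a..1}"], of "real m + 1"]
      by (simp add: add.commute)
    then have "((\<lambda>x. x ^ m) has_integral 1 ^ Suc m / (real m + 1) - a ^ Suc m / (real m + 1)) {a..1}"
      using a by (intro fundamental_theorem_of_calculus)
         (auto simp: has_real_derivative_iff_has_vector_derivative)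
    then have "((\<lambda>x. max q x ^ m) has_integral
        1 ^ Suc m / (real m + 1) - a ^ Suc m / (real m + 1)) {a..1}"
      by (rule has_integral_eq[rotated]) (use a in \<open>auto simp: max_def\<close>)
    then show ?thesis by (simp add: diff_divide_distrib)
  qed
  show ?thesis
  proof (cases "q \<le> p")
    case True
    then show ?thesis using pow[of p] assms by (simp add: bloc_win_def max_absorb1)
  next
    case False
    have "((\<lambda>x. q ^ m) has_integral (q - p) * q ^ m) {p..q}"
      using has_integral_const_real[of "q ^ m" p q] False by simp
    then have "((\<lambda>x. max q x ^ m) has_integral (q - p) * q ^ m) {p..q}"
      by (rule has_integral_eq[rotated]) (auto simp: max_def)
    from has_integral_combine[OF _ _ this pow[of q]]
    show ?thesis using False assms by (simp add: bloc_win_def max_absorb2)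
  qed
qed

lemma bloc_win_nonneg:
  assumes "0 \<le> p" "p \<le> 1" "0 \<le> q" "q \<le> 1"
  shows "0 \<le> bloc_win m p q"
  by (rule has_integral_nonneg[OF has_integral_power_max[OF assms]]) (use assms in auto)

text \<open>
  Fubini with the hand \<open>x\<close> of player 1 outermost: for fixed \<open>x\<close>, the opponents' hands range over a box
  of measure \<open>max q x ^ m\<close>.
\<close>
lemma measure_wins:
  assumes "0 \<le> p" "p \<le> 1" "0 \<le> q" "q \<le> 1"
  shows "measure (hands (Suc m)) (wins (Suc m) p q) = bloc_win m p q"
proof -
  let ?I = "{2..Suc m}" and ?W = "wins (Suc m) p q"
  let ?O = "PiM ?I (\<lambda>_. unif)"
  have ins: "{1..Suc m} = insert 1 ?I" by auto
  have H: "hands (Suc m) = PiM (insert 1 ?I) (\<lambda>_. unif)"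
    unfolding hands_def ins ..
  have [measurable]: "?W \<in> sets (PiM (insert 1 ?I) (\<lambda>_. unif))"
    using wins_sets[of "Suc m" p q] unfolding H by simp
  have inner: "(\<integral>\<^sup>+h. indicator ?W (h(1 := x)) \<partial>?O) = indicator {p..} x * ennreal (max q x ^ m)"
    if x: "0 \<le> x" "x \<le> 1" for x
  proof -
    let ?B = "{h \<in> space ?O. \<forall>j\<in>?I. h j \<in> {..<q} \<union> {..x}}"
    have "(\<integral>\<^sup>+h. indicator ?W (h(1 := x)) \<partial>?O) = (\<integral>\<^sup>+h. indicator {p..} x * indicator ?B h \<partial>?O)"
      by (intro nn_integral_cong)
         (auto simp: wins_def H space_PiM PiE_def extensional_def indicator_def)
    also have "\<dots> = indicator {p..} x * emeasure ?O ?B"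
      by (subst nn_integral_cmult_indicator) auto
    also have "emeasure ?O ?B = (\<Prod>j\<in>?I. emeasure unif ({..<q} \<union> {..x}))"
      by (rule emeasure_box) auto
    also have "emeasure unif ({..<q} \<union> {..x}) = ennreal (max q x)"
    proof (cases "q \<le> x")
      case True
      then have "{..<q} \<union> {..x} = {..x}" by auto
      then show ?thesis using emeasure_unif_below(2)[OF x] True by (simp only: max_absorb2)
    next
      case False
      then have "{..<q} \<union> {..x} = {..<q}" by auto
      then show ?thesis using emeasure_unif_below(1)[OF assms(3,4)] False
        by (simp only: max_absorb1 not_le less_imp_le)
    qed
    also have "(\<Prod>j\<in>?I. ennreal (max q x)) = ennreal (max q x ^ m)"
      using assms by (simp add: ennreal_power le_max_iff_disj)
    finally show ?thesis .
  qed
  have "emeasure (hands (Suc m)) ?W = (\<integral>\<^sup>+h. indicator ?W h \<partial>PiM (insert 1 ?I) (\<lambda>_. unif))"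
    unfolding H by (rule nn_integral_indicator[symmetric]) measurable
  also have "\<dots> = (\<integral>\<^sup>+x. (\<integral>\<^sup>+h. indicator ?W (h(1 := x)) \<partial>?O) \<partial>unif)"
    by (rule hands.product_nn_integral_insert_rev) (simp, simp, measurable)
  also have "\<dots> = (\<integral>\<^sup>+x. indicator {p..} x * ennreal (max q x ^ m) \<partial>unif)"
    by (intro nn_integral_cong_AE AE_uniform_measureI AE_I2 impI inner) auto
  also have "\<dots> = (\<integral>\<^sup>+x. indicator {p..} x * ennreal (max q x ^ m) * indicator {0..1} x \<partial>lborel)"
    by (subst nn_integral_uniform_measure) (auto simp: divide_ennreal_def)
  also have "\<dots> = (\<integral>\<^sup>+x. ennreal (indicator {p..1} x * max q x ^ m) \<partial>lborel)"
    by (intro nn_integral_cong) (use assms in \<open>auto simp: indicator_def\<close>)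
  also have "\<dots> = ennreal (bloc_win m p q)"
    by (rule nn_integral_has_integral_lebesgue[OF _ has_integral_power_max[OF assms]])
       (use assms in \<open>auto simp: le_max_iff_disj\<close>)
  finally show ?thesis using bloc_win_nonneg[OF assms] by (simp add: measure_def)
qed

lemma card_holders:
  "real (card (holders n t h)) = (\<Sum>i\<in>{1..n}. indicator {t i..} (h i))"
proof -
  have "real (card (holders n t h)) = (\<Sum>i\<in>holders n t h. 1)" by simp
  also have "\<dots> = (\<Sum>i\<in>{1..n}. if t i \<le> h i then 1 else 0)"
    unfolding holders_def by (rule sum.inter_filter) simp
  also have "\<dots> = (\<Sum>i\<in>{1..n}. indicator {t i..} (h i))"
    by (intro sum.cong) (auto simp: indicator_def)
  finally show ?thesis .
qed

lemma holders_empty_iff: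
  "h \<in> space (hands n) \<Longrightarrow> holders n t h = {} \<longleftrightarrow> h \<in> all_drop n t"
  unfolding holders_def all_drop_def not_le[symmetric] by blast

text \<open>
  A random variable that is piecewise in the number of holders becomes linear in indicators: the
  formula for at least one holder is off by exactly \<open>2\<close> when there is none.
\<close>
lemma stakes_factor_indicators:
  assumes "h \<in> space (hands n)"
  shows "stakes_factor n t h =
    (\<Sum>i\<in>{1..n}. indicator {t i..} (h i)) - 1 + 2 * indicator (all_drop n t) h"
  unfolding card_holders[symmetric] using holders_empty_iff[OF assms, of t]
  by (cases "holders n t h = {}") (simp_all add: stakes_factor_def)

text \<open>
  The immediate return is the stakes factor less one, plus \<open>n\<close> for a win and minus \<open>n\<close> for a loss;
  win minus loss is twice the win minus the event that player 1 holds.  When nobody holds, the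
  stakes factor \<open>1\<close> gives the correct return \<open>0\<close>.
\<close>
lemma immediate_return_indicators:
  assumes h: "h \<in> space (hands n)" and n: "n \<ge> 1"
  shows "immediate_return n (bloc p q) 1 h = stakes_factor n (bloc p q) h - 1
    + real n * (2 * indicator (wins n p q) h - indicator {p..} (h 1))"
proof (cases "holders n (bloc p q) h = {}")
  case True
  then have "\<not> p \<le> h 1" using n by (auto simp: holders_def bloc_def)
  then show ?thesis
    using True by (simp add: immediate_return_def stakes_factor_def wins_def)
next
  case False
  have one: "1 \<in> holders n (bloc p q) h \<longleftrightarrow> p \<le> h 1"
    using n by (auto simp: holders_def bloc_def)
  have "h \<in> wins n p q \<longleftrightarrow> p \<le> h 1 \<and> (\<forall>j\<in>holders n (bloc p q) h. h j \<le> h 1)"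
  proof -
    have "(\<forall>j\<in>holders n (bloc p q) h. h j \<le> h 1) \<longleftrightarrow> (\<forall>j\<in>{2..n}. h j < q \<or> h j \<le> h 1)"
    proof -
      have "{1..n} = insert 1 {2..n}" using n by auto
      then show ?thesis by (auto simp: holders_def bloc_def not_le[symmetric])
    qed
    then show ?thesis using h by (simp add: wins_def)
  qed
  then show ?thesis
    using False one by (auto simp: immediate_return_def stakes_factor_def Let_def indicator_def)
qed

lemma integrable_holds:
  assumes "i \<in> {1..n}"
  shows "integrable (hands n) (\<lambda>h. indicator {q..} (h i) :: real)"
proof -
  interpret prob_space "hands n" by (rule prob_space_hands)
  have [measurable]: "i \<in> {1..n}" by fact
  show ?thesis by (rule integrable_const_bound[of _ 1]) (auto simp: indicator_def)
qed

lemma integrable_event: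
  assumes "A \<in> sets (hands n)"
  shows "integrable (hands n) (\<lambda>h. indicator A h :: real)"
proof -
  interpret prob_space "hands n" by (rule prob_space_hands)
  show ?thesis
    using assms by (intro integrable_real_indicator) (auto simp: less_top[symmetric])
qed

lemma integrable_stakes_factor: "integrable (hands n) (stakes_factor n t)"
proof -
  interpret prob_space "hands n" by (rule prob_space_hands)
  show ?thesis
    by (subst Bochner_Integration.integrable_cong[OF refl stakes_factor_indicators])
       (auto intro!: Bochner_Integration.integrable_add Bochner_Integration.integrable_diff
          Bochner_Integration.integrable_sum integrable_mult_right
          integrable_holds integrable_event)
qed

lemma beta_bloc:
  assumes "0 \<le> p" "p \<le> 1" "0 \<le> q" "q \<le> 1"
  shows "beta (Suc m) (bloc p q) = bloc_beta m p q"
proof -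
  let ?n = "Suc m" and ?t = "bloc p q"
  interpret prob_space "hands ?n" by (rule prob_space_hands)
  have ins: "{1..?n} = insert 1 {2..?n}" by auto
  have t: "0 \<le> ?t i \<and> ?t i \<le> 1" for i using assms by (simp add: bloc_def)
  have sums: "(\<Sum>i\<in>{1..?n}. 1 - ?t i) = (1 - p) + real m * (1 - q)"
    and prods: "(\<Prod>i\<in>{1..?n}. ?t i) = p * q ^ m"
    unfolding ins by (simp_all add: bloc_def)
  define N where "N = (\<lambda>h. \<Sum>i\<in>{1..?n}. indicat_real {?t i..} (h i))"
  have intN: "integrable (hands ?n) N"
    unfolding N_def by (intro Bochner_Integration.integrable_sum integrable_holds)
  have "(\<integral>h. N h \<partial>hands ?n) = (\<Sum>i\<in>{1..?n}. \<integral>h. indicat_real {?t i..} (h i) \<partial>hands ?n)"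
    unfolding N_def by (intro Bochner_Integration.integral_sum integrable_holds)
  also have "\<dots> = (\<Sum>i\<in>{1..?n}. 1 - ?t i)"
    using t by (intro sum.cong refl expectation_holds) auto
  also note sums
  finally have expN: "(\<integral>h. N h \<partial>hands ?n) = (1 - p) + real m * (1 - q)" .
  have "beta ?n ?t = (\<integral>h. N h - 1 + 2 * indicat_real (all_drop ?n ?t) h \<partial>hands ?n)"
    unfolding beta_def N_def
    by (intro Bochner_Integration.integral_cong refl stakes_factor_indicators)
  also have "\<dots> = (\<integral>h. N h \<partial>hands ?n) - 1 + 2 * measure (hands ?n) (all_drop ?n ?t)"
    using intN integrable_event[OF all_drop_sets, of ?n ?t]
      sets.sets_into_space[OF all_drop_sets, of ?n ?t]
    by (simp add: Int_absorb2 prob_space)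
  also note expN
  also have "measure (hands ?n) (all_drop ?n ?t) = (\<Prod>i\<in>{1..?n}. ?t i)"
    using t by (intro measure_all_drop)
  also note prods
  finally show ?thesis by (simp add: bloc_beta_def)
qed

lemma alpha_bloc:
  assumes "0 \<le> p" "p \<le> 1" "0 \<le> q" "q \<le> 1"
  shows "alpha (Suc m) (bloc p q) = bloc_alpha m p q"
proof -
  let ?n = "Suc m"
  interpret prob_space "hands ?n" by (rule prob_space_hands)
  have one: "1 \<in> {1..?n}" by simp
  have W: "wins ?n p q \<in> sets (hands ?n)" by simp
  have "alpha ?n (bloc p q) = (\<integral>h. stakes_factor ?n (bloc p q) h - 1
      + real ?n * (2 * indicator (wins ?n p q) h - indicator {p..} (h 1)) \<partial>hands ?n)"
    unfolding alpha_def
    by (intro Bochner_Integration.integral_cong refl immediate_return_indicators) auto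
  also have "\<dots> = beta ?n (bloc p q) - 1
      + real ?n * (2 * measure (hands ?n) (wins ?n p q)
        - (\<integral>h. indicator {p..} (h 1) \<partial>hands ?n))"
    using integrable_holds[OF one, of p] integrable_event[OF W] integrable_stakes_factor[of ?n "bloc p q"]
      sets.sets_into_space[OF W]
    by (simp add: beta_def Int_absorb2 prob_space del: of_nat_Suc)
  also have "\<dots> = bloc_alpha m p q"
    unfolding beta_bloc[OF assms] measure_wins[OF assms] expectation_holds[OF one assms(1,2)]
    by (simp add: bloc_alpha_def add.commute)
  finally show ?thesis .
qed

section \<open>Forcing the return\<close>

text \<open>
  If the loss after \<open>k\<close> rounds is at most \<open>x \<le> 1\<close>, then one more round returns at least
  \<open>alpha - x * beta = x * (alpha - beta) + (1 - x) * alpha\<close>.  The termination condition bounds the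
  first summand below by \<open>- (1 - \<epsilon>) * x\<close>, and \<open>alpha \<ge> 0\<close> disposes of the second.
\<close>
lemma forced_return_lower_bound:
  fixes \<epsilon> :: real
  assumes \<epsilon>: "0 < \<epsilon>" "\<epsilon> < 1"
    and \<alpha>: "\<And>q. q \<in> {0..1} \<Longrightarrow> alpha n (bloc p q) \<ge> 0"
    and \<beta>: "\<And>q. q \<in> {0..1} \<Longrightarrow> beta n (bloc p q) \<ge> 0"
    and gap: "\<And>q. q \<in> {0..1} \<Longrightarrow> alpha n (bloc p q) \<ge> (beta n (bloc p q) - 1) + \<epsilon>"
  shows "forced_return n p k \<ge> - ((1 - \<epsilon>) ^ k)"
proof (induction k)
  case 0
  show ?case by simp
next
  case (Suc k)
  define x where "x = (1 - \<epsilon>) ^ k"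
  have x: "0 \<le> x" "x \<le> 1" using \<epsilon> by (auto simp: x_def power_le_one)
  have "- ((1 - \<epsilon>) * x) \<le> alpha n (bloc p q) + beta n (bloc p q) * forced_return n p k"
    if q: "q \<in> {0..1}" for q
  proof -
    let ?a = "alpha n (bloc p q)" and ?b = "beta n (bloc p q)"
    have "- ((1 - \<epsilon>) * x) \<le> x * (?a - ?b)"
      using mult_left_mono[OF gap[OF q] x(1)] by (simp add: algebra_simps)
    also have "\<dots> \<le> x * (?a - ?b) + (1 - x) * ?a" using x \<alpha>[OF q] by simp
    also have "\<dots> = ?a + ?b * (- x)" by (simp add: algebra_simps)
    also have "\<dots> \<le> ?a + ?b * forced_return n p k"
      using Suc \<beta>[OF q] by (intro add_left_mono mult_left_mono) (auto simp: x_def)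
    finally show ?thesis .
  qed
  then have "- ((1 - \<epsilon>) * x) \<le> forced_return n p (Suc k)"
    unfolding forced_return.simps by (intro cINF_greatest) auto
  then show ?case by (simp add: x_def)
qed

theorem corollary7p9:
  fixes n :: nat and p :: real
  assumes "n \<ge> 2" and "p = (1/2) powr (1 / (real n - 1))"
  shows "(\<exists>\<epsilon>\<in>{0<..<1::real}. \<forall>q\<in>{0..1::real}.
            alpha n (bloc p q) \<ge> 0 \<and>
            beta n (bloc p q) \<ge> 0 \<and>
            alpha n (bloc p q) \<ge> (beta n (bloc p q) - 1) + \<epsilon>)
         \<and> (SUP k. ereal (forced_return n p k)) \<ge> 0"
proof -
  obtain m where n: "n = Suc m" and m: "m > 0" using assms(1) by (cases n) auto
  have p0: "0 < p" using assms(2) by simp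
  have pm: "p ^ m = 1/2"
    using p0 m by (simp add: powr_realpow[symmetric] assms(2) n powr_powr)
  have p1: "p < 1"
  proof (rule ccontr)
    assume "\<not> p < 1"
    then have "1 \<le> p ^ m" by (intro one_le_power) simp
    then show False using pm by simp
  qed
  have cond: "alpha n (bloc p q) \<ge> 0" "beta n (bloc p q) \<ge> 0"
    "alpha n (bloc p q) \<ge> (beta n (bloc p q) - 1) + (1 - p)" if "q \<in> {0..1}" for q
    using that p0 p1 pm bloc_alpha_nonneg[of p m q] bloc_beta_nonneg[of p m q]
      bloc_alpha_minus_beta[of p m q]
    by (auto simp: n alpha_bloc beta_bloc)
  have "forced_return n p k \<ge> - ((1 - (1 - p)) ^ k)" for k
    using p0 p1 cond by (intro forced_return_lower_bound) auto
  then have lower: "ereal (- (p ^ k)) \<le> (SUP k. ereal (forced_return n p k))" for k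
    by (intro SUP_upper2[of k]) auto
  have "(\<lambda>k. - (p ^ k)) \<longlonglongrightarrow> - 0"
    using p0 p1 by (intro tendsto_minus LIMSEQ_realpow_zero) auto
  then have "(\<lambda>k. ereal (- (p ^ k))) \<longlonglongrightarrow> ereal 0" by simp
  then have "ereal 0 \<le> (SUP k. ereal (forced_return n p k))"
    by (rule LIMSEQ_le_const2) (use lower in blast)
  then have "(SUP k. ereal (forced_return n p k)) \<ge> 0" by (simp add: zero_ereal_def)
  moreover have "1 - p \<in> {0<..<1}" using p0 p1 by simp
  ultimately show ?thesis using cond by blast
qed

end
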